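(* Let $q=p^e>4$, where $p$ is a prime, and let $\ell$ be a positive integer with $2\ell\mid e$. Let $B\subseteq\mathbb F_{p^\ell}$ be an $\mathbb F_p$-linear subspace, let $n=tp^{e-\ell}$ with $1\le t\le|B|\le p^\ell$, and let $s\ge1$. Then, for every integer $k$ with $s<k\le\left\lfloor\frac{p^\ell+n}{p^\ell+1}\right\rfloor$ and every integer $h$ with $0\le h\le k-s$, there exists an $[n+s,k]_q$ generalized Roth-Lempel code $C$ such that $\dim\bigl(\operatorname{Hull}_{\ell}(C)\bigr)=h$.
   Context: For $q=p^e$ and $0\le\ell\le e-1$, the $\ell$-Galois inner product on $\mathbb F_q^N$ is $\langle\boldsymbol x,\boldsymbol y\rangle_\ell=\sum_i x_iy_i^{p^\ell}$. For a linear code $C\subseteq\mathbb F_q^N$, $C^{\perp_\ell}=\{\boldsymbol x\in\mathbb F_q^N:\langle\boldsymbol c,\boldsymbol x\rangle_\ell=0\ \text{for all }\boldsymbol c\in C\}$ and $\operatorname{Hull}_\ell(C)=C\cap C^{\perp_\ell}$. An $[n+s,k]_q$ generalized Roth-Lempel (GRL) code, where $1\le s\le k\le n$, is a code of the form $$\operatorname{GRL}_k(\boldsymbol a,\boldsymbol v,A_s)=\{(v_1f(a_1),\ldots,v_nf(a_n),(f_{k-s},\ldots,f_{k-1})A_s): f(x)=\textstyle\sum_{j=0}^{k-1}f_jx^j\in\mathbb F_q[x]\},$$ where $\boldsymbol a\in\mathbb F_q^n$ has pairwise distinct entries, $\boldsymbol v\in(\mathbb F_q^* )^n$ and $A_s\in\operatorname{GL}_s(\mathbb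 F_q)$. *)

theory Defs
  imports
    "HOL-Computational_Algebra.Primes"
    "HOL-Computational_Algebra.Polynomial"
    "HOL-Algebra.Embedded_Algebras"
    "Jordan_Normal_Form.VS_Connect"
begin

definition linear_code :: "nat \<Rightarrow> 'a::field vec set \<Rightarrow> bool" where
  "linear_code N C \<longleftrightarrow> VectorSpace.subspace class_ring C (module_vec TYPE('a) N)"

definition code_dim :: "nat \<Rightarrow> 'a::field vec set \<Rightarrow> nat" where
  "code_dim N C = vectorspace.dim class_ring ((module_vec TYPE('a) N)\<lparr>carrier := C\<rparr>)"

definition galois_ip :: "nat \<Rightarrow> nat \<Rightarrow> 'a::field vec \<Rightarrow> 'a vec \<Rightarrow> 'a" where
  "galois_ip p l x y = (\<Sum>i<dim_vec x. x $ i * (y $ i) ^ (p ^ l))"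

definition galois_dual :: "nat \<Rightarrow> nat \<Rightarrow> nat \<Rightarrow> 'a::field vec set \<Rightarrow> 'a vec set" where
  "galois_dual p l N C = {x \<in> carrier_vec N. \<forall>c\<in>C. galois_ip p l c x = 0}"

definition galois_hull :: "nat \<Rightarrow> nat \<Rightarrow> nat \<Rightarrow> 'a::field vec set \<Rightarrow> 'a vec set" where
  "galois_hull p l N C = C \<inter> galois_dual p l N C"

(* The row vector (f_{k-s},...,f_{k-1}) times A is the transpose of A applied to it as a
   column vector. The bound on the degree describes all f with coefficients f_0,...,f_{k-1}
   because k is positive. *)
definition grl_code ::
  "nat \<Rightarrow> nat \<Rightarrow> nat \<Rightarrow> 'a::field vec \<Rightarrow> 'a vec \<Rightarrow> 'a mat \<Rightarrow> 'a vec set" where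
  "grl_code n s k a v A =
     {vec n (\<lambda>i. v $ i * poly f (a $ i)) @\<^sub>v
        (transpose_mat A *\<^sub>v vec s (\<lambda>j. coeff f (k - s + j))) | f. degree f < k}"

definition is_grl_code :: "nat \<Rightarrow> nat \<Rightarrow> nat \<Rightarrow> 'a::field vec set \<Rightarrow> bool" where
  "is_grl_code n s k C \<longleftrightarrow>
     1 \<le> s \<and> s \<le> k \<and> k \<le> n \<and>
     (\<exists>a v A. a \<in> carrier_vec n \<and> inj_on (\<lambda>i. a $ i) {..<n} \<and>
        v \<in> carrier_vec n \<and> (\<forall>i<n. v $ i \<noteq> 0) \<and>
        A \<in> carrier_mat s s \<and> invertible_mat A \<and>
        C = grl_code n s k a v A)"

end

(* Write Q = p^l and let the evaluation points be the preimage, under the trace onto the field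
   F_Q, of a t-element subset of B.  Their Lagrange weights w_i then lie in F_Q, and since
   F_{Q^2} is contained in F_q each w_i is a norm y_i^(Q+1).  With v_i = y_i, the product of the
   evaluation vectors of f and g is the coefficient of x^(n-1) in f g^Q; by the bound on k it
   depends only on the top coefficients of f and g.  Multiplying the first r = k - s - h entries
   of v by some \<beta> with \<beta>^(Q+1) \<noteq> 1 and taking A = diag(1, ..., 1, \<alpha>) with \<alpha>^(Q+1) \<noteq> -1 makes
   the form diagonal, with nonzero entries, in the r evaluations at the first points and the s top
   coefficients.  These k - h functionals are independent, so the hull is their common kernel. *)
theory Submission
  imports Defs
begin

section \<open>Finite fields\<close>

text \<open>Multiplication by a nonzero \<open>x\<close> permutes \<open>K - {0}\<close>, so
  comparing the products over this set gives \<open>x ^ card (K - {0}) = 1\<close>. A subset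
  \<open>K\<close> is allowed because the result serves both the whole field and its subfield with
  \<open>p ^ l\<close> elements.\<close>

lemma power_card_eq_self:
  fixes K :: "'a::field set"
  assumes "finite K" "0 \<in> K" "x \<in> K"
    and mult: "\<And>x y. x \<in> K \<Longrightarrow> y \<in> K \<Longrightarrow> x * y \<in> K"
  shows "x ^ card K = x"
proof (cases "x = 0")
  case False
  have "(*) x ` (K - {0}) = K - {0}"
    by (rule endo_inj_surj) (use assms False in \<open>auto simp: inj_on_def\<close>)
  then have "\<Prod>(K - {0}) = (\<Prod>y\<in>K - {0}. x * y)"
    using prod.reindex[of "(*) x" "K - {0}" "\<lambda>y. y"] False by (simp add: inj_on_def)
  also have "\<dots> = x ^ card (K - {0}) * \<Prod>(K - {0})"
    by (simp add: prod.distrib)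
  finally have "x ^ card (K - {0}) = 1"
    using assms(1) by auto
  then show ?thesis
    using assms(1,2) by (metis card.remove mult.right_neutral power_Suc)
qed (use assms in \<open>auto simp: card_gt_0_iff zero_power\<close>)

text \<open>Pigeonhole: \<open>card Y\<close> fibres of size at most \<open>w\<close> share at least
  \<open>card Y * w\<close> points, so none can be smaller. This turns root bounds for the power map
  and the trace into surjectivity.\<close>

lemma card_fibre_eq:
  assumes "finite A" "finite Y" "f ` A \<subseteq> Y"
    and fibre: "\<And>y. y \<in> Y \<Longrightarrow> card {x \<in> A. f x = y} \<le> w"
    and card: "card Y * w \<le> card A" and "y \<in> Y"
  shows "card {x \<in> A. f x = y} = w"
proof -
  have "card A = (\<Sum>y\<in>Y. card {x \<in> A. f x = y})"
    using assms(1-3) by (metis (mono_tags, lifting) card_eq_sum sum.cong sum.group)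
  also have "\<dots> = card {x \<in> A. f x = y} + (\<Sum>y\<in>Y - {y}. card {x \<in> A. f x = y})"
    using assms by (simp add: sum.remove)
  also have "(\<Sum>y\<in>Y - {y}. card {x \<in> A. f x = y}) \<le> card (Y - {y}) * w"
    using sum_bounded_above[of "Y - {y}" "\<lambda>y. card {x \<in> A. f x = y}" w] fibre by simp
  finally have "card Y * w \<le> card {x \<in> A. f x = y} + card (Y - {y}) * w"
    using card by simp
  moreover have "card Y = Suc (card (Y - {y}))"
    using assms by (metis card.remove)
  ultimately show ?thesis
    using fibre[OF \<open>y \<in> Y\<close>] by simp
qed

lemma card_power_eq_le:
  fixes c :: "'a::field"
  assumes "n > 0"
  shows "card {x. x ^ n = c} \<le> n"
proof -
  let ?p = "Polynomial.monom 1 n - [:c:]"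
  have "Polynomial.coeff ?p n = 1"
    using assms by (cases n) auto
  then have "?p \<noteq> 0"
    by (metis coeff_0 zero_neq_one)
  from card_poly_roots_bound[OF this]
  have "card {x. x ^ n = c} \<le> Polynomial.degree ?p"
    by (simp add: poly_monom)
  also have "\<dots> \<le> n"
    by (rule order.trans[OF degree_diff_le_max]) (simp add: degree_monom_eq)
  finally show ?thesis .
qed

text \<open>Zero and the at most \<open>Q + 1\<close> solutions of \<open>x ^ (Q + 1) = c\<close>
  cannot exhaust the field. This supplies the scalars \<alpha> and \<beta>.\<close>

lemma ex_power_Suc_neq:
  fixes c :: "'a::{field,finite}"
  assumes "card (UNIV :: 'a set) > Q + 2"
  obtains x :: 'a where "x \<noteq> 0" "x ^ (Q + 1) \<noteq> c"
proof -
  have "card ({0} \<union> {x :: 'a. x ^ (Q + 1) = c}) \<le> Q + 2"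
    using card_Un_le[of "{0}" "{x :: 'a. x ^ (Q + 1) = c}"] card_power_eq_le[of "Q + 1" c] by simp
  then have "{0} \<union> {x :: 'a. x ^ (Q + 1) = c} \<noteq> UNIV"
    using assms by auto
  then show ?thesis
    using that by blast
qed

lemma diff_one_dvd_power_diff_one: "(x - 1 :: nat) dvd x ^ m - 1"
proof (cases "x = 0")
  case False
  then have "int (x - 1) dvd int (x ^ m - 1)"
    by (simp add: of_nat_diff power_diff_1_eq)
  then show ?thesis
    by (simp only: int_dvd_int_iff)
qed (cases m; simp)

text \<open>Since Q^2 - 1 divides q - 1, the exponent \<open>?w\<close> = (q - 1)/(Q - 1) is a
  multiple of Q + 1. Raising to the power \<open>?w\<close> sends nonzero elements to roots of
  \<open>z ^ (Q - 1) = 1\<close>, and counting shows that every such root is reached.\<close>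

lemma norm_surjective:
  fixes z :: "'a::{field,finite}"
  assumes card: "card (UNIV :: 'a set) = (Q ^ 2) ^ m" and "z \<noteq> 0" "z ^ Q = z"
  obtains y where "y \<noteq> 0" "y ^ (Q + 1) = z"
proof -
  let ?q = "card (UNIV :: 'a set)"
  have q: "?q > 1"
    using card_mono[of "UNIV :: 'a set" "{0, 1}"] by simp
  have "Q \<noteq> 0"
    using q unfolding card by (cases "Q = 0") (simp_all add: power_0_left split: if_splits)
  moreover have "Q \<noteq> 1"
    using q unfolding card by auto
  ultimately have Q: "Q > 1"
    by simp
  have "(Q - 1) * (Q + 1) dvd ?q - 1"
    using diff_one_dvd_power_diff_one[of "Q ^ 2" m] unfolding card
    by (simp add: power2_eq_square algebra_simps diff_mult_distrib)
  then obtain c where c: "?q - 1 = (Q - 1) * ((Q + 1) * c)"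
    by (metis dvd_def mult.assoc)
  have "c > 0"
    using c q by (intro gr0I) simp
  let ?w = "(Q + 1) * c"
  let ?Y = "{z :: 'a. z ^ (Q - 1) = 1}"
  have x1: "x ^ (?q - 1) = 1" if "x \<noteq> 0" for x :: 'a
  proof -
    have "x ^ ?q = x"
      by (rule power_card_eq_self) auto
    moreover have "x ^ ?q = x * x ^ (?q - 1)"
      using q by (cases ?q) auto
    ultimately show ?thesis
      using that by simp
  qed
  have "card {x \<in> UNIV - {0}. x ^ ?w = z} = ?w"
  proof (rule card_fibre_eq[where Y = ?Y])
    show "(\<lambda>x. x ^ ?w) ` (UNIV - {0}) \<subseteq> ?Y"
      using x1 unfolding c by (auto simp: mult.commute simp flip: power_mult)
    have "card ?Y * ?w \<le> (Q - 1) * ?w"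
      using card_power_eq_le[of "Q - 1" "1 :: 'a"] Q by (intro mult_right_mono) auto
    also have "\<dots> = card (UNIV - {0 :: 'a})"
      using c by (simp only: card_Diff_singleton UNIV_I finite_class.finite_UNIV)
    finally show "card ?Y * ?w \<le> card (UNIV - {0 :: 'a})" .
    show "card {x \<in> UNIV - {0 :: 'a}. x ^ ?w = y} \<le> ?w" for y
    proof -
      have "card {x \<in> UNIV - {0 :: 'a}. x ^ ?w = y} \<le> card {x. x ^ ?w = y}"
        by (intro card_mono) auto
      also have "\<dots> \<le> ?w"
        using \<open>c > 0\<close> by (intro card_power_eq_le) simp
      finally show ?thesis .
    qed
    have "z * z ^ (Q - 1) = z"
      using assms(3) Q by (cases Q) auto
    then show "z \<in> ?Y"
      using \<open>z \<noteq> 0\<close> by simp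
  qed auto
  then have "card {x \<in> UNIV - {0}. x ^ ?w = z} \<noteq> 0"
    using \<open>c > 0\<close> by simp
  then have "{x \<in> UNIV - {0}. x ^ ?w = z} \<noteq> {}"
    by (metis card.empty)
  then obtain x where "x \<noteq> 0" "x ^ ?w = z"
    by auto
  \<comment> \<open>As \<open>?w = (Q + 1) * c\<close>, the element \<open>x ^ c\<close> has (Q +
    1)-st power \<open>x ^ ?w = z\<close>.\<close>
  then show thesis
    using that[of "x ^ c"] by (metis mult.commute power_mult power_not_zero)
qed

section \<open>Lagrange weights of trace preimages\<close>

text \<open>Lagrange interpolation recovers \<open>f\<close> from its values on \<open>S\<close>.
  Each product \<open>L a\<close> is monic of degree \<open>card S - 1\<close>, so the top
  coefficient of the interpolation formula is the weighted sum of values.\<close>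

lemma lagrange_sum_eq_coeff:
  fixes S :: "'a::field set" and f :: "'a poly"
  assumes "finite S" "Polynomial.degree f < card S"
  shows "(\<Sum>a\<in>S. inverse (\<Prod>b\<in>S - {a}. a - b) * poly f a) = Polynomial.coeff f (card S - 1)"
proof -
  define w where "w a = inverse (\<Prod>b\<in>S - {a}. a - b)" for a
  define L where "L a = (\<Prod>b\<in>S - {a}. [:-b, 1:])" for a
  have deg: "Polynomial.degree (L a) = card S - 1" if "a \<in> S" for a
    unfolding L_def using that assms(1)
    by (subst degree_prod_eq_sum_degree) (auto simp: card_Diff_singleton)
  have lead: "Polynomial.coeff (L a) (card S - 1) = 1" if "a \<in> S" for a
    using lead_coeff_prod[of "\<lambda>b. [:-b, 1:]" "S - {a}"] deg[OF that]
    unfolding L_def by simp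
  have L_eval: "w a * poly (L a) x = (if x = a then 1 else 0)" if "a \<in> S" "x \<in> S" for a x
    using that assms(1) unfolding L_def w_def poly_prod by auto
  have f: "f = (\<Sum>a\<in>S. Polynomial.smult (w a * poly f a) (L a))" (is "_ = ?g")
  proof (rule poly_eqI_degree[where A = S])
    show "poly f x = poly ?g x" if "x \<in> S" for x
    proof -
      have "poly ?g x = (\<Sum>a\<in>S. poly f a * (w a * poly (L a) x))"
        by (simp add: poly_sum mult_ac)
      also have "\<dots> = (\<Sum>a\<in>S. if x = a then poly f a else 0)"
        using that by (intro sum.cong) (auto simp: L_eval)
      finally show ?thesis
        using that assms(1) by simp
    qed
    have "Polynomial.degree ?g \<le> card S - 1"
      by (intro degree_sum_le assms(1)) (metis degree_smult_le deg)
    then show "Polynomial.degree ?g < card S"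
      using assms(2) by linarith
  qed (use assms in auto)
  have "Polynomial.coeff f (card S - 1) = Polynomial.coeff ?g (card S - 1)"
    using f by simp
  also have "\<dots> = (\<Sum>a\<in>S. w a * poly f a)"
    unfolding coeff_sum coeff_smult by (intro sum.cong) (simp_all only: lead mult.right_neutral)
  finally show ?thesis
    by (simp add: w_def)
qed

section \<open>The trace polynomial, its fibres and its derivative\<close>

text \<open>On the field with Q^m elements this evaluates to the trace onto the field with Q
  elements. It is kept as a polynomial because its degree bounds the fibres and its derivative
  determines the Lagrange weights.\<close>

definition trace_poly :: "nat \<Rightarrow> nat \<Rightarrow> 'a::field poly" where
  "trace_poly Q m = (\<Sum>j<m. Polynomial.monom 1 (Q ^ j))"

lemma degree_trace_poly:
  assumes "Q > 1" "m > 0"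
  shows "Polynomial.degree (trace_poly Q m :: 'a::field poly) = Q ^ (m - 1)"
    and "Polynomial.coeff (trace_poly Q m :: 'a poly) (Q ^ (m - 1)) = 1"
proof -
  have *: "Polynomial.coeff (trace_poly Q m :: 'a poly) i = (\<Sum>j<m. if Q ^ j = i then 1 else 0)" for i
    by (simp add: trace_poly_def coeff_sum)
  have "(\<Sum>j<m. if Q ^ j = Q ^ (m - 1) then 1 else 0 :: 'a) = (\<Sum>j<m. if j = m - 1 then 1 else 0)"
    using assms by (intro sum.cong) auto
  then show c: "Polynomial.coeff (trace_poly Q m :: 'a poly) (Q ^ (m - 1)) = 1"
    using assms(2) by (simp add: *)
  have "Polynomial.coeff (trace_poly Q m :: 'a poly) i = 0" if "i > Q ^ (m - 1)" for i
  proof -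
    have "Q ^ j \<noteq> i" if "j < m" for j
      using \<open>i > Q ^ (m - 1)\<close> power_increasing[of j "m - 1" Q] that assms by auto
    then show ?thesis
      by (simp add: *)
  qed
  then have "Polynomial.degree (trace_poly Q m :: 'a poly) \<le> Q ^ (m - 1)"
    by (intro degree_le) auto
  then show "Polynomial.degree (trace_poly Q m :: 'a poly) = Q ^ (m - 1)"
    using le_degree[of "trace_poly Q m :: 'a poly" "Q ^ (m - 1)"] c by simp
qed

lemma degree_trace_poly_diff_const:
  assumes "Q > 1" "m > 0"
  shows "Polynomial.degree (trace_poly Q m - [:y:] :: 'a::field poly) = Q ^ (m - 1)"
    and "Polynomial.coeff (trace_poly Q m - [:y:] :: 'a poly) (Q ^ (m - 1)) = 1"
proof -
  let ?P = "trace_poly Q m :: 'a poly"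
  have P: "Polynomial.degree ?P = Q ^ (m - 1)"
    using assms by (rule degree_trace_poly)
  have lt: "Polynomial.degree [:- y:] < Polynomial.degree ?P"
    unfolding P using assms by simp
  have "Polynomial.degree (?P + [:- y:]) = Q ^ (m - 1)"
    using degree_add_eq_left[OF lt] P by (rule trans)
  moreover have "?P - [:y:] = ?P + [:- y:]"
    by (simp add: poly_eq_iff coeff_pCons split: nat.split)
  ultimately show "Polynomial.degree (?P - [:y:]) = Q ^ (m - 1)"
    by (simp only:)
  have "Q ^ (m - 1) > 0"
    using assms by simp
  then have "Polynomial.coeff [:y:] (Q ^ (m - 1)) = 0"
    by (intro coeff_eq_0) simp
  then show "Polynomial.coeff (?P - [:y:]) (Q ^ (m - 1)) = 1"
    using degree_trace_poly(2)[OF assms, where 'a = 'a] by (simp only: coeff_diff diff_zero)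
qed

lemma pderiv_trace_poly:
  assumes "of_nat Q = (0 :: 'a::field)" "m > 0"
  shows "pderiv (trace_poly Q m :: 'a poly) = 1"
proof -
  have "pderiv (Polynomial.monom 1 (Q ^ j) :: 'a poly) = (if j = 0 then 1 else 0)" for j
    using assms(1) by (cases j) (simp_all add: pderiv_monom monom_0 one_pCons)
  moreover have "pderiv (sum f A) = (\<Sum>j\<in>A. pderiv (f j))" for f :: "nat \<Rightarrow> 'a poly" and A
    by (induction A rule: infinite_finite_induct) (auto simp: pderiv_add)
  ultimately show ?thesis
    using assms(2) by (simp add: trace_poly_def)
qed

text \<open>The trace takes values among the at most Q elements fixed by Frobenius, and by degree
  each fibre has at most \<open>Q ^ (m - 1)\<close> points. These bounds multiply to the size of the
  field, so the fibre bound is attained.\<close>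

lemma card_trace_fibre:
  fixes y :: "'a::{field,finite}"
  assumes Q: "Q > 1" and m: "m > 0" and card: "card (UNIV :: 'a set) = Q ^ m"
    and frob: "\<And>x y :: 'a. (x + y) ^ Q = x ^ Q + y ^ Q"
    and y: "y ^ Q = y"
  shows "card {x. poly (trace_poly Q m) x = y} = Q ^ (m - 1)"
proof -
  let ?Y = "{y :: 'a. y ^ Q = y}"
  have "card {x \<in> UNIV. poly (trace_poly Q m) x = y} = Q ^ (m - 1)"
  proof (rule card_fibre_eq[where Y = ?Y])
    have sum_frob: "(\<Sum>j\<in>J. g j) ^ Q = (\<Sum>j\<in>J. g j ^ Q)" if "finite J" for J :: "nat set" and g :: "nat \<Rightarrow> 'a"
      using that by induction (use Q frob in auto)
    have "poly (trace_poly Q m) x ^ Q = poly (trace_poly Q m) x" for x :: 'a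
    proof -
      have "poly (trace_poly Q m) x ^ Q = (\<Sum>j<m. x ^ (Q ^ Suc j))"
        by (simp add: trace_poly_def poly_sum poly_monom sum_frob mult.commute flip: power_mult)
      \<comment> \<open>Frobenius shifts the exponents by one. From here on \<open>x\<close> is
        added to both sides, so that the shifted sum is completed at the bottom; the surplus top
        term \<open>x ^ Q ^ m\<close> equals \<open>x\<close> and cancels it.\<close>
      also have "\<dots> + x ^ Q ^ 0 = (\<Sum>j<Suc m. x ^ (Q ^ j))"
        by (subst sum.lessThan_Suc_shift) (simp add: add.commute)
      also have "\<dots> = (\<Sum>j<m. x ^ (Q ^ j)) + x ^ Q ^ m"
        by simp
      also have "x ^ Q ^ m = x"
        unfolding card[symmetric] by (rule power_card_eq_self) auto
      finally show ?thesis
        by (simp add: trace_poly_def poly_sum poly_monom)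
    qed
    then show "poly (trace_poly Q m) ` UNIV \<subseteq> ?Y"
      by auto
    show "card {x \<in> UNIV. poly (trace_poly Q m) x = y} \<le> Q ^ (m - 1)" for y :: 'a
    proof -
      let ?p = "trace_poly Q m - [:y:]"
      have "?p \<noteq> 0"
        using degree_trace_poly_diff_const(2)[OF Q m, of y] by (metis coeff_0 zero_neq_one)
      then show ?thesis
        using card_poly_roots_bound[of ?p] degree_trace_poly_diff_const(1)[OF Q m, of y] by simp
    qed
    \<comment> \<open>Splitting off zero brings \<open>y ^ Q = y\<close> into the form with constant
      right-hand side to which the root bound applies.\<close>
    have "?Y \<subseteq> {0} \<union> {y. y ^ (Q - 1) = 1}"
    proof
      fix y :: 'a assume "y \<in> ?Y"
      moreover have "y ^ Q = y * y ^ (Q - 1)"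
        using Q by (cases Q) auto
      ultimately show "y \<in> {0} \<union> {y. y ^ (Q - 1) = 1}"
        by simp
    qed
    then have "card ?Y \<le> card ({0} \<union> {y :: 'a. y ^ (Q - 1) = 1})"
      by (intro card_mono) auto
    also have "\<dots> \<le> 1 + (Q - 1)"
      using card_Un_le[of "{0 :: 'a}" "{y. y ^ (Q - 1) = 1}"] card_power_eq_le[of "Q - 1" "1 :: 'a"] Q
      by simp
    finally have "card ?Y \<le> Q"
      using Q by simp
    then have "card ?Y * Q ^ (m - 1) \<le> Q * Q ^ (m - 1)"
      by (rule mult_right_mono) simp
    also have "\<dots> = Q ^ m"
      using m by (cases m) auto
    finally show "card ?Y * Q ^ (m - 1) \<le> card (UNIV :: 'a set)"
      using card by simp
  qed (use y in auto)
  then show ?thesis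
    by simp
qed

text \<open>The evaluation points form the full preimage of a subset of the fixed field of Frobenius
  under the trace, so that \<open>\<Prod>b\<in>S. X - b\<close> equals \<open>\<Prod>\<tau>\<in>T. Tr X - \<tau>\<close>; as the trace polynomial has
  derivative 1, the Lagrange weights of \<open>S\<close> lie in that fixed field.\<close>

lemma trace_preimage:
  fixes T :: "'a::{field,finite} set"
  assumes Q: "Q > 1" and m: "m > 0" and card: "card (UNIV :: 'a set) = Q ^ m"
    and frob: "\<And>x y :: 'a. (x + y) ^ Q = x ^ Q + y ^ Q" and char: "of_nat Q = (0 :: 'a)"
    and T: "\<And>y. y \<in> T \<Longrightarrow> y ^ Q = y"
  defines "S \<equiv> {x. poly (trace_poly Q m) x \<in> T}"
  shows "card S = card T * Q ^ (m - 1)"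
    and "a \<in> S \<Longrightarrow> inverse (\<Prod>b\<in>S - {a}. a - b) ^ Q = inverse (\<Prod>b\<in>S - {a}. a - b)"
proof -
  let ?P = "trace_poly Q m :: 'a poly"
  have "S = (\<Union>y\<in>T. {x. poly ?P x = y})"
    by (auto simp: S_def)
  also have "card \<dots> = (\<Sum>y\<in>T. card {x. poly ?P x = y})"
    by (rule card_UN_disjoint) auto
  also have "\<dots> = card T * Q ^ (m - 1)"
    using card_trace_fibre[OF Q m card frob] T by simp
  finally show cS: "card S = card T * Q ^ (m - 1)" .

  note degP = degree_trace_poly_diff_const(1)[OF Q m, where 'a = 'a]
    and leadP = degree_trace_poly_diff_const(2)[OF Q m, where 'a = 'a]
  have ne: "?P - [:y:] \<noteq> 0" for y
    using leadP[of y] by (metis coeff_0 zero_neq_one)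
  \<comment> \<open>Both sides are monic of degree \<open>card S\<close> and vanish on
    \<open>S\<close>, hence coincide.\<close>
  have prods: "(\<Prod>b\<in>S. [:-b, 1:]) = (\<Prod>y\<in>T. ?P - [:y:])" (is "?l = ?r")
  proof (rule poly_eqI_degree_lead_coeff[where A = S and n = "card S"])
    have dl: "Polynomial.degree ?l = card S"
      by (subst degree_prod_eq_sum_degree) auto
    have dr: "Polynomial.degree ?r = card S"
      using ne by (subst degree_prod_eq_sum_degree) (auto simp: degP cS)
    show "Polynomial.degree ?l \<le> card S" "Polynomial.degree ?r \<le> card S"
      using dl dr by auto
    have "lead_coeff ?l = 1"
      by (simp add: lead_coeff_prod)
    moreover have "lead_coeff ?r = 1"
      unfolding lead_coeff_prod degP leadP by simp
    ultimately show "Polynomial.coeff ?l (card S) = Polynomial.coeff ?r (card S)"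
      by (simp add: dl dr)
    show "poly ?l z = poly ?r z" if "z \<in> S" for z
    proof -
      have "poly ?l z = 0"
        using that by (auto simp: poly_prod)
      moreover have "poly ?r z = 0"
        using that by (auto simp: poly_prod S_def)
      ultimately show ?thesis
        by simp
    qed
  qed simp
  show "inverse (\<Prod>b\<in>S - {a}. a - b) ^ Q = inverse (\<Prod>b\<in>S - {a}. a - b)" if a: "a \<in> S"
  proof -
    define \<tau> where "\<tau> = poly ?P a"
    have \<tau>: "\<tau> \<in> T"
      using a by (simp add: S_def \<tau>_def)
    \<comment> \<open>The product is the derivative of \<open>?l\<close> at \<open>a\<close>: every
      summand with \<open>c\<close> other than \<open>a\<close> contains the factor
      \<open>a - a\<close>.\<close>
    have "(\<Prod>b\<in>S - {a}. a - b) = (\<Sum>c\<in>S. \<Prod>b\<in>S - {c}. a - b)"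
      using a by (subst sum.remove[of _ a]) (auto intro!: sum.neutral prod_zero)
    also have "\<dots> = poly (pderiv ?l) a"
      by (simp add: pderiv_prod poly_sum poly_prod pderiv_pCons)
    also have "\<dots> = poly (pderiv ?r) a"
      by (simp add: prods)
    \<comment> \<open>Each factor of \<open>?r\<close> has derivative 1, so only differences of
      elements of \<open>T\<close> remain, and these are fixed by Frobenius.\<close>
    also have "\<dots> = (\<Sum>c\<in>T. \<Prod>y\<in>T - {c}. \<tau> - y)"
      by (simp add: pderiv_prod pderiv_diff pderiv_trace_poly[OF char m] poly_sum poly_prod \<tau>_def
          pderiv_pCons)
    also have "\<dots> = (\<Prod>y\<in>T - {\<tau>}. \<tau> - y)"
      using \<tau> by (subst sum.remove[of _ \<tau>]) (auto intro!: sum.neutral prod_zero)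
    finally have eq: "(\<Prod>b\<in>S - {a}. a - b) = (\<Prod>y\<in>T - {\<tau>}. \<tau> - y)" .
    have diff: "(x - y) ^ Q = x ^ Q - y ^ Q" for x y :: 'a
      using frob[of "x - y" y] by (simp add: algebra_simps)
    have "(\<Prod>y\<in>T - {\<tau>}. \<tau> - y) ^ Q = (\<Prod>y\<in>T - {\<tau>}. \<tau> - y)"
      unfolding prod_power_distrib using T \<tau> by (intro prod.cong) (auto simp: diff)
    then show ?thesis
      by (simp add: eq power_inverse)
  qed
qed

section \<open>Linear images as codes\<close>

text \<open>Rank-nullity with trivial kernel. Linearity is asked for on \<open>carrier_vec h\<close>
  only, since the vector type contains vectors of all lengths.\<close>

lemma code_dim_linear_image:
  fixes T :: "'a::field vec \<Rightarrow> 'a vec"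
  assumes carrier: "\<And>x. x \<in> carrier_vec h \<Longrightarrow> T x \<in> carrier_vec N"
    and add: "\<And>x y. x \<in> carrier_vec h \<Longrightarrow> y \<in> carrier_vec h \<Longrightarrow> T (x + y) = T x + T y"
    and smult: "\<And>c x. x \<in> carrier_vec h \<Longrightarrow> T (c \<cdot>\<^sub>v x) = c \<cdot>\<^sub>v T x"
    and inj: "inj_on T (carrier_vec h)"
  shows "linear_code N (T ` carrier_vec h)" and "code_dim N (T ` carrier_vec h) = h"
proof -
  let ?V = "module_vec TYPE('a) h" and ?W = "module_vec TYPE('a) N"
  interpret V: vec_space "TYPE('a)" h .
  interpret W: vec_space "TYPE('a)" N .
  interpret lin: linear_map "class_ring :: 'a ring" ?V ?W T
    by unfold_locales
      (auto simp: LinearCombinations.module_hom_def module_vec_simps carrier add smult)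
  have im: "lin.imT = T ` carrier_vec h"
    by (simp add: lin.im_def module_vec_simps)
  show "linear_code N (T ` carrier_vec h)"
    using lin.imT_is_subspace unfolding linear_code_def im .
  have "vectorspace.dim class_ring (W.vs lin.imT) + vectorspace.dim class_ring (V.vs lin.kerT) = h"
    using lin.rank_nullity[OF V.fin_dim] V.dim_is_n by simp
  moreover have "vectorspace.dim class_ring (V.vs lin.kerT) = 0"
    using inj by (intro lin.inj_imp_dim_ker0) (simp add: module_vec_simps)
  ultimately show "code_dim N (T ` carrier_vec h) = h"
    unfolding code_dim_def im by simp
qed

text \<open>The disjunct \<open>f = 0\<close> is needed for \<open>h = 0\<close>, as the zero polynomial has degree 0.\<close>

lemma code_dim_poly_image:
  fixes L :: "'a::field poly \<Rightarrow> 'a vec"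
  assumes carrier: "\<And>f. L f \<in> carrier_vec N"
    and add: "\<And>f g. L (f + g) = L f + L g"
    and smult: "\<And>c f. L (Polynomial.smult c f) = c \<cdot>\<^sub>v L f"
    and inj: "\<And>f. f = 0 \<or> Polynomial.degree f < h \<Longrightarrow> L f = 0\<^sub>v N \<Longrightarrow> f = 0"
  shows "linear_code N (L ` {f. f = 0 \<or> Polynomial.degree f < h})"
    and "code_dim N (L ` {f. f = 0 \<or> Polynomial.degree f < h}) = h"
proof -
  \<comment> \<open>\<open>P\<close> identifies coordinate vectors of length \<open>h\<close> with
    polynomials of degree below \<open>h\<close>; for \<open>h = 0\<close> its only value is the
    zero polynomial.\<close>
  define P :: "'a vec \<Rightarrow> 'a poly" where "P x = (\<Sum>j<h. Polynomial.monom (x $ j) j)" for x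
  have coeff_P: "Polynomial.coeff (P x) j = (if j < h then x $ j else 0)" for x j
    by (simp add: P_def coeff_sum)
  have P_add: "P (x + y) = P x + P y" if "x \<in> carrier_vec h" "y \<in> carrier_vec h" for x y
    using that by (auto simp: poly_eq_iff coeff_P)
  have P_smult: "P (c \<cdot>\<^sub>v x) = Polynomial.smult c (P x)" if "x \<in> carrier_vec h" for c x
    using that by (auto simp: poly_eq_iff coeff_P)
  have P_bound: "P x = 0 \<or> Polynomial.degree (P x) < h" for x
  proof (cases "h = 0")
    case False
    then have "Polynomial.degree (P x) < h"
      by (intro degree_lessI) (auto simp: coeff_P)
    then show ?thesis ..
  qed (simp add: P_def)
  have "P ` carrier_vec h = {f. f = 0 \<or> Polynomial.degree f < h}"
  proof (intro equalityI subsetI)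
    fix f :: "'a poly" assume f: "f \<in> {f. f = 0 \<or> Polynomial.degree f < h}"
    then have "f = P (vec h (Polynomial.coeff f))"
      by (auto simp: poly_eq_iff coeff_P coeff_eq_0)
    then show "f \<in> P ` carrier_vec h"
      by auto
  qed (use P_bound in auto)
  then have im: "L ` {f. f = 0 \<or> Polynomial.degree f < h} = (\<lambda>x. L (P x)) ` carrier_vec h"
    by (simp flip: image_image)
  have "x = y" if xy: "x \<in> carrier_vec h" "y \<in> carrier_vec h" "L (P x) = L (P y)" for x y
  proof -
    have "L (P (x + (-1) \<cdot>\<^sub>v y)) = L (P x) + (-1) \<cdot>\<^sub>v L (P y)"
      unfolding P_add[OF xy(1) smult_carrier_vec[THEN iffD2, OF xy(2)]] P_smult[OF xy(2)] add smult ..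
    also have "\<dots> = 0\<^sub>v N"
      using carrier[of "P y"] by (auto simp: xy(3))
    finally have "P (x + (-1) \<cdot>\<^sub>v y) = 0"
      using inj P_bound by blast
    then have "x $ j = y $ j" if "j < h" for j
      using that xy coeff_P[of "x + (-1) \<cdot>\<^sub>v y" j] by simp
    then show "x = y"
      using xy by auto
  qed
  then have "inj_on (\<lambda>x. L (P x)) (carrier_vec h)"
    by (auto intro: inj_onI)
  then show "linear_code N (L ` {f. f = 0 \<or> Polynomial.degree f < h})"
    and "code_dim N (L ` {f. f = 0 \<or> Polynomial.degree f < h}) = h"
    unfolding im using code_dim_linear_image[of h "\<lambda>x. L (P x)" N]
    by (simp_all add: carrier P_add P_smult add smult)
qed

section \<open>Generalized Roth-Lempel codes with a diagonal matrix\<close>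

lemma sum_lessThan_add: "(\<Sum>i<n + s. F i) = (\<Sum>i<n. F i) + (\<Sum>j<s. F (n + j :: nat))"
  for F :: "nat \<Rightarrow> 'a::comm_monoid_add"
  by (induction s) (simp_all add: add.assoc)

definition grl_word ::
  "nat \<Rightarrow> nat \<Rightarrow> nat \<Rightarrow> 'a::field vec \<Rightarrow> 'a vec \<Rightarrow> 'a mat \<Rightarrow> 'a poly \<Rightarrow> 'a vec" where
  "grl_word n s k a v A f =
     vec n (\<lambda>i. v $ i * poly f (a $ i)) @\<^sub>v
       (transpose_mat A *\<^sub>v vec s (\<lambda>j. Polynomial.coeff f (k - s + j)))"

lemma grl_code_eq_image: "grl_code n s k a v A = grl_word n s k a v A ` {f. Polynomial.degree f < k}"
  unfolding grl_code_def grl_word_def by blast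

lemma grl_word_diag_index:
  assumes "i < n + s"
  shows "grl_word n s k a v (mat_diag s d) f $ i =
    (if i < n then v $ i * poly f (a $ i) else d (i - n) * Polynomial.coeff f (k - s + (i - n)))"
proof -
  have "(transpose_mat (mat_diag s d) *\<^sub>v x) $ j = d j * x $ j"
    if "j < s" "x \<in> carrier_vec s" for j and x :: "'a vec"
  proof -
    have "(transpose_mat (mat_diag s d) *\<^sub>v x) $ j = (\<Sum>i<s. (if i = j then d j else 0) * x $ i)"
      using that by (auto simp: mat_diag_def scalar_prod_def atLeast0LessThan intro!: sum.cong)
    also have "\<dots> = (\<Sum>i<s. if i = j then d j * x $ j else 0)"
      by (intro sum.cong) auto
    finally show ?thesis
      using that by simp
  qed
  then show ?thesis
    using assms by (auto simp: grl_word_def mat_diag_def)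
qed

lemma dim_grl_word: "dim_vec (grl_word n s k a v (mat_diag s d) f) = n + s"
  by (simp add: grl_word_def mat_diag_def)

lemma invertible_mat_diag:
  fixes d :: "nat \<Rightarrow> 'a::field"
  assumes "\<And>j. j < s \<Longrightarrow> d j \<noteq> 0"
  shows "invertible_mat (mat_diag s d)"
proof -
  let ?D = "mat_diag s d" and ?E = "mat_diag s (\<lambda>j. inverse (d j))"
  have dim: "dim_row ?D = s" "dim_col ?D = s" "dim_row ?E = s"
    using mat_diag_dim[of s d] mat_diag_dim[of s "\<lambda>j. inverse (d j)"] by blast+
  have "mat_diag s (\<lambda>j. d j * inverse (d j)) = 1\<^sub>m s"
    by (rule eq_matI) (simp_all add: mat_diag_def assms)
  moreover have "mat_diag s (\<lambda>j. inverse (d j) * d j) = 1\<^sub>m s"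
    by (rule eq_matI) (simp_all add: mat_diag_def assms)
  ultimately have "?D * ?E = 1\<^sub>m s" "?E * ?D = 1\<^sub>m s"
    by (simp_all only: mat_diag_diag)
  then show ?thesis
    unfolding invertible_mat_def inverts_mat_def square_mat.simps
    by (intro conjI exI[of _ ?E]) (simp_all only: dim)
qed

text \<open>A nonzero \<open>G * u\<close> has degree below \<open>n\<close>, so it cannot vanish at
  \<open>n\<close> distinct points; the evaluation part alone makes the map injective. The case
  \<open>G = 1\<close> gives the code itself, and a product of linear factors gives its
  hull.\<close>

lemma code_dim_grl_word_image:
  fixes a v :: "'a::field vec" and d :: "nat \<Rightarrow> 'a" and n s k h :: nat
  assumes "inj_on (\<lambda>i. a $ i) {..<n}" "\<And>i. i < n \<Longrightarrow> v $ i \<noteq> 0"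
    and "G \<noteq> 0" "Polynomial.degree G + h \<le> n"
  defines "C \<equiv> (\<lambda>u. grl_word n s k a v (mat_diag s d) (G * u)) ` {u. u = 0 \<or> Polynomial.degree u < h}"
  shows "linear_code (n + s) C" and "code_dim (n + s) C = h"
proof -
  let ?L = "\<lambda>u. grl_word n s k a v (mat_diag s d) (G * u)"
  have 1: "?L u \<in> carrier_vec (n + s)" for u
    by (rule carrier_vecI) (rule dim_grl_word)
  have 2: "?L (u + w) = ?L u + ?L w" for u w
    by (intro eq_vecI) (auto simp: dim_grl_word grl_word_diag_index algebra_simps)
  have 3: "?L (Polynomial.smult c u) = c \<cdot>\<^sub>v ?L u" for c u
    by (intro eq_vecI) (auto simp: dim_grl_word grl_word_diag_index algebra_simps)
  have 4: "u = 0" if u: "u = 0 \<or> Polynomial.degree u < h" and L: "?L u = 0\<^sub>v (n + s)" for u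
  proof (rule ccontr)
    assume "u \<noteq> 0"
    with u assms(3,4) have deg: "Polynomial.degree (G * u) < n"
      by (simp add: degree_mult_eq)
    have "poly (G * u) x = 0" if "x \<in> (\<lambda>i. a $ i) ` {..<n}" for x
    proof -
      from that obtain i where i: "i < n" "x = a $ i"
        by auto
      have "?L u $ i = 0"
        using L i by simp
      then show ?thesis
        using i assms(2) by (simp add: grl_word_diag_index)
    qed
    moreover have "card ((\<lambda>i. a $ i) ` {..<n}) = n"
      using assms(1) by (simp add: card_image)
    ultimately have "G * u = 0"
      using deg by (intro poly_eqI_degree[where A = "(\<lambda>i. a $ i) ` {..<n}"]) auto
    then show False
      using \<open>u \<noteq> 0\<close> \<open>G \<noteq> 0\<close> by simp
  qed
  show "linear_code (n + s) C"
    unfolding C_def by (rule code_dim_poly_image(1)[where L = ?L]) (rule 1 2 3 4; assumption?)+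
  show "code_dim (n + s) C = h"
    unfolding C_def by (rule code_dim_poly_image(2)[where L = ?L]) (rule 1 2 3 4; assumption?)+
qed

section \<open>The Galois form on code words and the hull\<close>

text \<open>The degree of \<open>f * g ^ Q\<close> is at most \<open>(k - 1) * (Q + 1)\<close>,
  hence at most \<open>N\<close>. The coefficient at \<open>N\<close> can be nonzero only if both
  bounds are attained, and then it is a product of leading coefficients.\<close>

lemma coeff_mult_power_top:
  fixes f g :: "'a::field poly"
  assumes "Polynomial.degree f < k" "Polynomial.degree g < k" "(k - 1) * (Q + 1) \<le> N" "Q > 0"
  shows "Polynomial.coeff (f * g ^ Q) N =
    (if (k - 1) * (Q + 1) = N then 1 else 0) * (Polynomial.coeff f (k - 1) * Polynomial.coeff g (k - 1) ^ Q)"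
proof (cases "(k - 1) * (Q + 1) = N \<and> Polynomial.degree f = k - 1 \<and> Polynomial.degree g = k - 1")
  case True
  then have N: "N = Polynomial.degree f + Polynomial.degree (g ^ Q)"
    by (cases "g = 0") (use assms(4) in \<open>auto simp: degree_power_eq zero_power\<close>)
  have "Polynomial.coeff (f * g ^ Q) N = lead_coeff f * lead_coeff (g ^ Q)"
    unfolding N by (rule coeff_mult_degree_sum)
  then show ?thesis
    using True by (simp add: lead_coeff_power)
next
  case False
  have le: "Polynomial.degree (f * g ^ Q) \<le> Polynomial.degree f + Polynomial.degree g * Q"
    by (rule order.trans[OF degree_mult_le]) (simp add: degree_power_le)
  have "Polynomial.degree f + Polynomial.degree g * Q < N"
  proof (cases "Polynomial.degree f = k - 1 \<and> Polynomial.degree g = k - 1")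
    case True
    then show ?thesis
      using False assms(3) by simp
  next
    case False
    then have "Polynomial.degree f < k - 1 \<and> Polynomial.degree g * Q \<le> (k - 1) * Q \<or>
        Polynomial.degree f \<le> k - 1 \<and> Polynomial.degree g * Q < (k - 1) * Q"
      using assms(1,2,4) by auto
    then have "Polynomial.degree f + Polynomial.degree g * Q < (k - 1) + (k - 1) * Q"
      by linarith
    then show ?thesis
      using assms(3) by simp
  qed
  then have "Polynomial.coeff (f * g ^ Q) N = 0"
    using le by (intro coeff_eq_0) linarith
  moreover have "(k - 1) * (Q + 1) = N \<Longrightarrow> Polynomial.coeff f (k - 1) = 0 \<or> Polynomial.coeff g (k - 1) = 0"
    using False assms(1,2) coeff_eq_0[of f "k - 1"] coeff_eq_0[of g "k - 1"] by linarith
  ultimately show ?thesis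
    using assms(4) by auto
qed

lemma galois_ip_grl_word:
  fixes a v :: "'a::field vec"
  shows "galois_ip p l (grl_word n s k a v (mat_diag s d) f) (grl_word n s k a v (mat_diag s d) g) =
    (\<Sum>i<n. v $ i ^ (p ^ l + 1) * poly (f * g ^ p ^ l) (a $ i)) +
    (\<Sum>j<s. d j ^ (p ^ l + 1) * (Polynomial.coeff f (k - s + j) * Polynomial.coeff g (k - s + j) ^ p ^ l))"
  unfolding galois_ip_def dim_grl_word sum_lessThan_add
  by (intro arg_cong2[where f = "(+)"] sum.cong refl)
    (simp_all add: grl_word_diag_index power_mult_distrib mult_ac)

text \<open>With r = k - s - h, the hull consists of the words of those \<open>g\<close> that vanish
  at the first r points and have zero top \<open>s\<close> coefficients. Such \<open>g\<close> are
  the multiples \<open>G * u\<close> of a fixed polynomial of degree r with \<open>u\<close> zero or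
  of degree below \<open>h\<close>. The hypothesis \<open>lagrange\<close> is how the choice of
  points enters.\<close>

lemma dim_galois_hull_grl_code:
  fixes a v :: "'a::field vec" and d y :: "nat \<Rightarrow> 'a" and n s k h p l :: nat
  defines "Q \<equiv> p ^ l"
  defines "C \<equiv> grl_code n s k a v (mat_diag s d)"
  assumes "p > 0"
    and inj: "inj_on (\<lambda>i. a $ i) {..<n}"
    and y: "\<And>i. i < n \<Longrightarrow> y i \<noteq> 0"
    and lagrange: "\<And>f. Polynomial.degree f < n \<Longrightarrow>
      (\<Sum>i<n. y i ^ (Q + 1) * poly f (a $ i)) = Polynomial.coeff f (n - 1)"
    and v: "\<And>i. i < n \<Longrightarrow> v $ i = (if i < k - s - h then \<beta> else 1) * y i"
    and \<beta>: "\<beta> \<noteq> 0" "\<beta> ^ (Q + 1) \<noteq> 1"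
    and d: "\<And>j. d j = (if j = s - 1 then \<alpha> else 1)"
    and \<alpha>: "\<alpha> \<noteq> 0" "\<alpha> ^ (Q + 1) \<noteq> -1"
    and s: "s \<ge> 1" "s < k" and k: "(k - 1) * (Q + 1) < n" and h: "h \<le> k - s"
  shows "code_dim (n + s) (galois_hull p l (n + s) C) = h"
proof -
  have "Q > 0"
    using \<open>p > 0\<close> by (simp add: Q_def)
  define r where "r = k - s - h"
  have "k - 1 \<le> (k - 1) * (Q + 1)"
    by simp
  then have kn: "k \<le> n" and "r \<le> n"
    using k s unfolding r_def by linarith+
  define W where "W = grl_word n s k a v (mat_diag s d)"
  have C: "C = W ` {f. Polynomial.degree f < k}"
    by (simp add: C_def W_def grl_code_eq_image)
  \<comment> \<open>\<epsilon> records whether \<open>k\<close> is extremal, that is, whether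
    \<open>f * g ^ Q\<close> can reach degree \<open>n - 1\<close>.\<close>
  define \<epsilon> :: 'a where "\<epsilon> = (if (k - 1) * (Q + 1) = n - 1 then 1 else 0)"
  define b where "b j = d j ^ (Q + 1) + (if j = s - 1 then \<epsilon> else 0)" for j
  \<comment> \<open>This is the change of the weight \<open>y i ^ (Q + 1)\<close> when
    \<open>y i\<close> is multiplied by \<beta>.\<close>
  define c where "c i = (\<beta> ^ (Q + 1) - 1) * y i ^ (Q + 1)" for i
  \<comment> \<open>At \<open>j = s - 1\<close> the value is \<alpha>^(Q+1) + \<epsilon>: for
    \<epsilon> = 0 it is nonzero since \<alpha> is, and for \<epsilon> = 1 since \<alpha>^(Q+1)
    differs from -1.\<close>
  have b: "b j \<noteq> 0" for j
    using \<alpha> by (auto simp: b_def d \<epsilon>_def add_eq_0_iff2)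
  have c: "c i \<noteq> 0" if "i < r" for i
    using \<beta> y[of i] that \<open>r \<le> n\<close> by (simp add: c_def)

  have ip: "galois_ip p l (W f) (W g) =
      (\<Sum>i<r. c i * (poly f (a $ i) * poly g (a $ i) ^ Q)) +
      (\<Sum>j<s. b j * (Polynomial.coeff f (k - s + j) * Polynomial.coeff g (k - s + j) ^ Q))"
    if fg: "Polynomial.degree f < k" "Polynomial.degree g < k" for f g
  proof -
    let ?F = "\<lambda>i. poly (f * g ^ Q) (a $ i)"
    let ?T = "\<lambda>j. Polynomial.coeff f (k - s + j) * Polynomial.coeff g (k - s + j) ^ Q"
    have "Polynomial.degree (f * g ^ Q) \<le> Polynomial.degree f + Polynomial.degree g * Q"
      by (rule order.trans[OF degree_mult_le]) (simp add: degree_power_le)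
    also have "\<dots> \<le> (k - 1) + (k - 1) * Q"
      using fg by (intro add_mono mult_right_mono) auto
    also have "\<dots> < n"
      using k by simp
    finally have deg: "Polynomial.degree (f * g ^ Q) < n" .
    have "(\<Sum>i<n. v $ i ^ (Q + 1) * ?F i) =
        (\<Sum>i<n. y i ^ (Q + 1) * ?F i + (if i < r then c i * ?F i else 0))"
      by (intro sum.cong) (auto simp: v c_def power_mult_distrib r_def algebra_simps)
    also have "\<dots> = (\<Sum>i<n. y i ^ (Q + 1) * ?F i) + (\<Sum>i<n. if i < r then c i * ?F i else 0)"
      by (rule sum.distrib)
    also have "(\<Sum>i<n. if i < r then c i * ?F i else 0) = (\<Sum>i<r. c i * ?F i)"
      using \<open>r \<le> n\<close> by (intro sum.mono_neutral_cong_right) auto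
    \<comment> \<open>The unmodified weights extract the coefficient at \<open>n - 1\<close>. The
      index \<open>s - 1\<close> stands for the coefficient at
      \<open>k - s + (s - 1) = k - 1\<close>.\<close>
    also have "(\<Sum>i<n. y i ^ (Q + 1) * ?F i) = \<epsilon> * ?T (s - 1)"
      using lagrange[OF deg] coeff_mult_power_top[OF fg, of Q "n - 1"] k s \<open>Q > 0\<close>
      by (simp add: \<epsilon>_def)
    also have "\<epsilon> * ?T (s - 1) = (\<Sum>j<s. if j = s - 1 then \<epsilon> * ?T j else 0)"
      using s by simp
    finally have "galois_ip p l (W f) (W g) =
        (\<Sum>i<r. c i * ?F i) +
        ((\<Sum>j<s. if j = s - 1 then \<epsilon> * ?T j else 0) + (\<Sum>j<s. d j ^ (Q + 1) * ?T j))"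
      unfolding W_def galois_ip_grl_word Q_def by (simp only: add_ac)
    also have "(\<Sum>j<s. if j = s - 1 then \<epsilon> * ?T j else 0) + (\<Sum>j<s. d j ^ (Q + 1) * ?T j) =
        (\<Sum>j<s. b j * ?T j)"
      unfolding sum.distrib[symmetric] by (intro sum.cong) (auto simp: b_def algebra_simps)
    finally show ?thesis
      by simp
  qed

  define G where "G = (\<Prod>i<r. [:- (a $ i), 1:])"
  have G0: "G \<noteq> 0" and degG: "Polynomial.degree G = r"
    unfolding G_def by (auto simp: degree_prod_eq_sum_degree)
  \<comment> \<open>Linear factors are split off one at a time; distinctness of the points moves the
    next root to the cofactor.\<close>
  have G_dvd: "G dvd g" if "\<And>i. i < r \<Longrightarrow> poly g (a $ i) = 0" for g
  proof -
    have "(\<Prod>i\<in>I. [:- (a $ i), 1:]) dvd g" if "finite I" "I \<subseteq> {..<r}" for I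
      using that
    proof (induction I)
      case (insert i I)
      then obtain u where u: "g = (\<Prod>i\<in>I. [:- (a $ i), 1:]) * u"
        by auto
      have "a $ i \<noteq> a $ j" if "j \<in> I" for j
      proof -
        have "j < n" "i < n" "j \<noteq> i"
          using insert that \<open>r \<le> n\<close> by auto
        then show ?thesis
          using inj by (auto dest: inj_onD)
      qed
      then have "\<forall>j\<in>I. a $ i \<noteq> a $ j"
        by blast
      then have "poly (\<Prod>i\<in>I. [:- (a $ i), 1:]) (a $ i) \<noteq> 0"
        using insert.hyps(1) by (auto simp: poly_prod)
      moreover have "poly g (a $ i) = 0"
        using insert \<open>\<And>i. i < r \<Longrightarrow> poly g (a $ i) = 0\<close> by auto
      ultimately have "poly u (a $ i) = 0"
        unfolding u by simp
      then have "[:- (a $ i), 1:] dvd u"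
        by (simp add: poly_eq_0_iff_dvd)
      then show ?case
        using insert.hyps unfolding u by (simp add: mult_dvd_mono mult.commute del: mult_pCons_left mult_pCons_right)
    qed simp
    then show ?thesis
      unfolding G_def by auto
  qed

  have "galois_hull p l (n + s) C = (\<lambda>u. W (G * u)) ` {u. u = 0 \<or> Polynomial.degree u < h}"
  proof (intro equalityI subsetI)
    fix x assume "x \<in> galois_hull p l (n + s) C"
    then obtain g where g: "x = W g" "Polynomial.degree g < k"
      and "\<forall>f. Polynomial.degree f < k \<longrightarrow> galois_ip p l (W f) (W g) = 0"
      by (auto simp: galois_hull_def galois_dual_def C)
    then have orth: "galois_ip p l (W f) (W g) = 0" if "Polynomial.degree f < k" for f
      using that by blast
    have root: "poly g (a $ i) = 0" if "i < r" for i
    proof -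
      \<comment> \<open>This test polynomial vanishes at the other r - 1 points, and its degree r -
        1 < k - s kills all top coefficients, so only the term of \<open>c i\<close>
        survives.\<close>
      let ?f = "\<Prod>m\<in>{..<r} - {i}. [:- (a $ m), 1:]"
      have deg_f: "Polynomial.degree ?f = r - 1"
        using that by (subst degree_prod_eq_sum_degree) (auto simp: card_Diff_singleton)
      have "r - 1 < k - s"
        using that by (simp add: r_def)
      then have "Polynomial.degree ?f < k" and "Polynomial.coeff ?f (k - s + j) = 0" for j
        using deg_f by (auto intro!: coeff_eq_0)
      then have "(\<Sum>m<r. c m * (poly ?f (a $ m) * poly g (a $ m) ^ Q)) = 0"
        using orth[of ?f] ip[of ?f g] g(2) by simp
      moreover have "poly ?f (a $ m) = 0" if "m < r" "m \<noteq> i" for m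
        using that by (auto simp: poly_prod)
      ultimately have "c i * (poly ?f (a $ i) * poly g (a $ i) ^ Q) = 0"
        using that by (subst (asm) sum.remove[of _ i]) auto
      moreover have "poly ?f (a $ i) \<noteq> 0"
        using that inj \<open>r \<le> n\<close> by (auto simp: poly_prod dest: inj_onD)
      ultimately show ?thesis
        using c[OF that] by simp
    qed
    have top: "Polynomial.coeff g (k - s + j) = 0" if "j < s" for j
    proof -
      \<comment> \<open>The evaluation terms already vanish because \<open>g\<close> has the roots
        found above; the monomial then isolates the term of \<open>b j\<close>.\<close>
      let ?f = "Polynomial.monom 1 (k - s + j) :: 'a poly"
      have "Polynomial.degree ?f < k"
        using that s by (simp add: degree_monom_eq)
      from orth[OF this] have "(\<Sum>i<s. b i * (Polynomial.coeff ?f (k - s + i) * Polynomial.coeff g (k - s + i) ^ Q)) = 0"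
        using ip[of ?f g] \<open>Polynomial.degree ?f < k\<close> g(2) \<open>Q > 0\<close> root by (simp add: zero_power)
      also have "(\<Sum>i<s. b i * (Polynomial.coeff ?f (k - s + i) * Polynomial.coeff g (k - s + i) ^ Q)) =
          (\<Sum>i<s. if i = j then b j * Polynomial.coeff g (k - s + j) ^ Q else 0)"
        by (intro sum.cong) auto
      finally show ?thesis
        using that b[of j] by simp
    qed
    obtain u where u: "g = G * u"
      using G_dvd root by (meson dvdE)
    \<comment> \<open>Otherwise \<open>g\<close> has degree at least r + h = k - s, and its leading
      coefficient is one of the top coefficients shown to be zero.\<close>
    have "u = 0 \<or> Polynomial.degree u < h"
    proof (rule disjCI)
      assume "\<not> Polynomial.degree u < h"
      show "u = 0"
      proof (rule ccontr)
        assume "u \<noteq> 0"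
        then have "Polynomial.degree g = r + Polynomial.degree u"
          using G0 degG by (simp add: u degree_mult_eq)
        then have "Polynomial.degree g \<ge> k - s"
          using \<open>\<not> Polynomial.degree u < h\<close> by (simp add: r_def)
        then obtain j where "Polynomial.degree g = k - s + j"
          using le_Suc_ex by blast
        then have "lead_coeff g = 0"
          using top[of j] g(2) s by simp
        then show False
          using \<open>u \<noteq> 0\<close> G0 by (simp add: u)
      qed
    qed
    then show "x \<in> (\<lambda>u. W (G * u)) ` {u. u = 0 \<or> Polynomial.degree u < h}"
      using g(1) u by auto
  next
    fix x assume "x \<in> (\<lambda>u. W (G * u)) ` {u. u = 0 \<or> Polynomial.degree u < h}"
    then obtain u where x: "x = W (G * u)" and u: "u = 0 \<or> Polynomial.degree u < h"
      by auto
    have deg: "G * u = 0 \<or> Polynomial.degree (G * u) < k - s"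
      using u G0 degG h by (cases "u = 0") (auto simp: degree_mult_eq r_def)
    then have "Polynomial.degree (G * u) < k"
      using s by auto
    moreover have "galois_ip p l (W f) (W (G * u)) = 0" if "Polynomial.degree f < k" for f
    proof -
      have "poly (G * u) (a $ i) = 0" if "i < r" for i
        using that by (auto simp: G_def poly_prod)
      moreover have "Polynomial.coeff (G * u) (k - s + j) = 0" for j
        using deg by (auto intro: coeff_eq_0)
      ultimately show ?thesis
        using that \<open>Polynomial.degree (G * u) < k\<close> \<open>Q > 0\<close>
        by (simp add: ip zero_power del: poly_mult)
    qed
    ultimately have "W (G * u) \<in> C" "\<forall>c\<in>C. galois_ip p l c (W (G * u)) = 0"
      unfolding C by blast+
    moreover have "W (G * u) \<in> carrier_vec (n + s)"
      unfolding W_def by (rule carrier_vecI) (rule dim_grl_word)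
    ultimately show "x \<in> galois_hull p l (n + s) C"
      unfolding galois_hull_def galois_dual_def x by blast
  qed
  then show ?thesis
    using code_dim_grl_word_image(2)[OF inj, of v G h s k d] y v \<beta>(1) G0 degG kn h
    by (simp add: W_def r_def)
qed

section \<open>Characteristic of the field and assembly of the code\<close>

text \<open>Translation by 1 permutes the field, so summing over all elements shows that the field
  size is zero in the field. The characteristic is therefore a prime dividing
  \<open>p ^ e\<close>.\<close>

lemma CHAR_eq_prime:
  assumes "prime p" "card (UNIV :: 'a::{field,finite} set) = p ^ e"
  shows "CHAR('a) = p"
proof -
  have "(\<Sum>x\<in>UNIV. x + 1 :: 'a) = (\<Sum>x\<in>UNIV. x)"
    by (rule sum.reindex_bij_witness[of _ "\<lambda>x. x - 1" "\<lambda>x. x + 1"]) auto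
  then have "of_nat (card (UNIV :: 'a set)) = (0 :: 'a)"
    by (simp add: sum.distrib)
  then have "CHAR('a) dvd p ^ e"
    unfolding assms(2) of_nat_eq_0_iff_char_dvd .
  moreover have "prime CHAR('a)"
    by (rule prime_CHAR_semidom) (rule finite_imp_CHAR_pos, simp)
  ultimately show ?thesis
    using assms(1) by (metis prime_dvd_power primes_dvd_imp_eq)
qed

theorem mainTheorem10:
  fixes p e l t n s k h :: nat
    and Fp Fpl B :: "'a::{field,finite} set"
  assumes "prime p"
    and "card (UNIV :: 'a set) = p ^ e"
    and "p ^ e > 4"
    and "l \<ge> 1"
    and "2 * l dvd e"
    and "subfield Fp (class_ring :: 'a ring)" and "card Fp = p"
    and "subfield Fpl (class_ring :: 'a ring)" and "card Fpl = p ^ l"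
    and "B \<subseteq> Fpl"
    and "subalgebra Fp B (class_ring :: 'a ring)"
    and "1 \<le> t" and "t \<le> card B" and "card B \<le> p ^ l"
    and "n = t * p ^ (e - l)"
    and "s \<ge> 1"
    and "s < k"
    and "k \<le> (p ^ l + n) div (p ^ l + 1)"
    and "h \<le> k - s"
  shows "\<exists>C :: 'a vec set. linear_code (n + s) C \<and> code_dim (n + s) C = k \<and>
           is_grl_code n s k C \<and>
           code_dim (n + s) (galois_hull p l (n + s) C) = h"
proof -
  define Q where "Q = p ^ l"
  obtain m' where m': "e = 2 * l * m'"
    using assms(5) by auto
  define m where "m = 2 * m'"
  have "p > 1"
    using assms(1) by (rule prime_gt_1_nat)
  have "m' > 0"
    using assms(3) by (intro gr0I) (simp add: m')
  then have m: "m > 0"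
    by (simp add: m_def)
  have "Q > 1"
    using \<open>p > 1\<close> assms(4) unfolding Q_def by (intro one_less_power) auto
  \<comment> \<open>The first form of the field size serves the trace onto the field with Q
    elements, the second the surjectivity of the norm.\<close>
  have card: "card (UNIV :: 'a set) = Q ^ m" and card2: "card (UNIV :: 'a set) = (Q ^ 2) ^ m'"
    unfolding assms(2) Q_def m' m_def by (simp_all add: mult_ac flip: power_mult)
  have char: "CHAR('a) = p"
    using assms(1,2) by (rule CHAR_eq_prime)
  have frob: "(x + y) ^ Q = x ^ Q + y ^ Q" for x y :: 'a
    by (rule freshmans_dream'[where n = l]) (simp_all add: char assms(1) Q_def)
  have "p dvd Q"
    using assms(4) by (simp add: Q_def)
  then have char_Q: "of_nat Q = (0 :: 'a)"
    unfolding of_nat_eq_0_iff_char_dvd char .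
  have fixed: "y ^ Q = y" if "y \<in> B" for y
  proof -
    note Fpl = subringE[OF subfieldE(1)[OF assms(8)]]
    have "0 \<in> Fpl" and "x * z \<in> Fpl" if "x \<in> Fpl" "z \<in> Fpl" for x z
      using Fpl(2) Fpl(6)[OF that] by simp_all
    then have "y ^ card Fpl = y"
      using that assms(10) by (intro power_card_eq_self) auto
    then show ?thesis
      by (simp add: assms(9) Q_def)
  qed
  obtain T where "T \<subseteq> B" "card T = t"
    using assms(13) by (metis obtain_subset_with_card_n)
  define S where "S = {x :: 'a. poly (trace_poly Q m) x \<in> T}"
  have T: "y ^ Q = y" if "y \<in> T" for y
    using that fixed \<open>T \<subseteq> B\<close> by auto
  note pre = trace_preimage[where T = T, OF \<open>Q > 1\<close> m card frob char_Q T, folded S_def]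
  have "Q ^ (m - 1) = p ^ (e - l)"
    unfolding Q_def m_def m' by (simp add: algebra_simps flip: power_mult)
  then have "card S = n"
    using pre(1) \<open>card T = t\<close> assms(15) by simp
  then obtain \<phi> where \<phi>: "bij_betw \<phi> {..<n} S"
    using ex_bij_betw_nat_finite[of S] by (auto simp: atLeast0LessThan)
  define w where "w x = inverse (\<Prod>b\<in>S - {x}. x - b)" for x
  have "\<exists>y. y \<noteq> 0 \<and> y ^ (Q + 1) = w x" if "x \<in> S" for x
  proof -
    have "w x \<noteq> 0" "w x ^ Q = w x"
      using pre(2)[OF _ that] by (simp_all add: w_def)
    then show ?thesis
      by (metis norm_surjective[OF card2])
  qed
  then obtain \<eta> where \<eta>: "\<And>x. x \<in> S \<Longrightarrow> \<eta> x \<noteq> 0 \<and> \<eta> x ^ (Q + 1) = w x"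
    by metis
  have "Q ^ 2 \<le> p ^ e"
    using card2 assms(2) \<open>m' > 0\<close> \<open>Q > 1\<close> by (metis self_le_power one_le_power less_imp_le)
  \<comment> \<open>The field has at least Q^2 elements, which exceeds Q + 2 except for Q = 2; there
    the hypothesis \<open>p ^ e > 4\<close> gives the same bound.\<close>
  moreover have "Q = 2 \<or> Q + 2 < Q ^ 2"
  proof (cases "Q = 2")
    case False
    then have "3 * Q \<le> Q * Q"
      using \<open>Q > 1\<close> by (intro mult_right_mono) auto
    then have "Q + 2 < Q * Q"
      using \<open>Q > 1\<close> \<open>Q \<noteq> 2\<close> by linarith
    then show ?thesis
      by (simp add: power2_eq_square)
  qed simp
  ultimately have large: "Q + 2 < card (UNIV :: 'a set)"
    using assms(2,3) by auto
  obtain \<alpha> :: 'a where \<alpha>: "\<alpha> \<noteq> 0" "\<alpha> ^ (Q + 1) \<noteq> -1"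
    using large by (rule ex_power_Suc_neq)
  obtain \<beta> :: 'a where \<beta>: "\<beta> \<noteq> 0" "\<beta> ^ (Q + 1) \<noteq> 1"
    using large by (rule ex_power_Suc_neq)

  \<comment> \<open>Clearing the floor and subtracting Q + 1 bounds the degree of
    \<open>f * g ^ Q\<close> by \<open>n - 1\<close>.\<close>
  have "k * (Q + 1) \<le> Q + n"
    using assms(18) by (simp add: Q_def less_eq_div_iff_mult_less_eq)
  then have k: "(k - 1) * (Q + 1) < n"
    using assms(17) by (cases k) auto
  moreover have "k - 1 \<le> (k - 1) * (Q + 1)"
    by simp
  ultimately have kn: "k \<le> n"
    using assms(17) by linarith

  define a where "a = vec n \<phi>"
  define y where "y i = \<eta> (\<phi> i)" for i
  define v where "v = vec n (\<lambda>i. (if i < k - s - h then \<beta> else 1) * y i)"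
  define d where "d j = (if j = s - 1 then \<alpha> else 1)" for j
  define C where "C = grl_code n s k a v (mat_diag s d)"
  have \<phi>_S: "\<phi> i \<in> S" if "i < n" for i
    using \<phi> that by (auto simp: bij_betw_def)
  have inj: "inj_on (\<lambda>i. a $ i) {..<n}"
    using \<phi> by (auto simp: a_def bij_betw_def inj_on_def)
  have y: "y i \<noteq> 0" if "i < n" for i
    using \<eta> \<phi>_S[OF that] by (simp add: y_def)
  have v: "v $ i \<noteq> 0" if "i < n" for i
    using that y \<beta>(1) by (simp add: v_def)
  have lagrange: "(\<Sum>i<n. y i ^ (Q + 1) * poly f (a $ i)) = Polynomial.coeff f (n - 1)"
    if "Polynomial.degree f < n" for f
  proof -
    have "(\<Sum>i<n. y i ^ (Q + 1) * poly f (a $ i)) = (\<Sum>i<n. w (\<phi> i) * poly f (\<phi> i))"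
      using \<eta> \<phi>_S by (intro sum.cong) (auto simp: y_def a_def)
    also have "\<dots> = (\<Sum>x\<in>S. w x * poly f x)"
      using \<phi> by (rule sum.reindex_bij_betw)
    also have "\<dots> = Polynomial.coeff f (n - 1)"
      unfolding w_def using lagrange_sum_eq_coeff[of S f] that \<open>card S = n\<close> by simp
    finally show ?thesis .
  qed
  \<comment> \<open>Since \<open>k\<close> is positive, the disjunct \<open>u = 0\<close> adds no
    polynomial here.\<close>
  have C_image: "C = (\<lambda>u. grl_word n s k a v (mat_diag s d) (1 * u)) ` {u. u = 0 \<or> Polynomial.degree u < k}"
    unfolding C_def grl_code_eq_image using assms(17) by (intro image_cong) auto
  have "linear_code (n + s) C" "code_dim (n + s) C = k"
    unfolding C_image using code_dim_grl_word_image[OF inj v, of 1 k s k d] kn by simp_all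
  moreover have "is_grl_code n s k C"
    unfolding is_grl_code_def
  proof (intro conjI exI)
    show "invertible_mat (mat_diag s d)"
      using \<alpha>(1) by (intro invertible_mat_diag) (simp add: d_def)
    show "C = grl_code n s k a v (mat_diag s d)"
      by (rule C_def)
    show "mat_diag s d \<in> carrier_mat s s"
      by (rule mat_diag_dim)
  qed (use assms(16,17) kn inj v in \<open>auto simp: a_def v_def\<close>)
  moreover have "code_dim (n + s) (galois_hull p l (n + s) C) = h"
    unfolding C_def
    by (rule dim_galois_hull_grl_code[where p = p and l = l and y = y and \<beta> = \<beta> and \<alpha> = \<alpha>, folded Q_def])
      (use \<open>p > 1\<close> inj y lagrange \<beta> \<alpha> assms(16,17,19) k in \<open>simp_all add: v_def d_def\<close>)
  ultimately show ?thesis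
    by blast
qed

end
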